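(* Let $\Omega\subseteq\mathbb{R}^d$ and $\Omega'\subseteq\mathbb{R}^s$ be Borel sets, and fix $\mu\in\mathbb{P}(\Omega)$ and a Mercer kernel $\kappa:\Omega'\times\Omega'\to\mathbb{R}$ with RKHS $\mathcal{K}$. Suppose $\kappa$ has a feature map $\psi:\Omega'\to\mathcal{K}$ and there exists a function $L:\Omega'\times\Omega'\to\mathbb{R}_+$ such that $$\|\psi(x)-\psi(y)\|_{\mathcal{K}}\le L(x,y)\,|x-y|\qquad\text{for all }x,y\in\Omega'.$$ Suppose $F,G\in L^q_\mu(\Omega;\Omega')$ are such that $L(F(\cdot),G(\cdot))\in L^p_\mu(\Omega;\mathbb{R})$ for Hölder exponents $p,q\in[1,\infty]$ satisfying $1/p+1/q=1$. Then $$\mathrm{MMD}_\kappa(F_\sharp\mu,G_\sharp\mu)\le\|L(F(\cdot),G(\cdot))\|_{L^p_\mu(\Omega;\mathbb{R})}\,\|F-G\|_{L^q_\mu(\Omega;\Omega')}.$$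
   Context: $\mathbb{P}(\Omega)$ denotes the Borel probability measures on $\Omega$; $F_\sharp\mu$ is the pushforward; $L^p_\mu$ is the $L^p$ space with respect to $\mu$; $|\cdot|$ is the Euclidean norm. A Mercer kernel on $\Omega'$ is a symmetric function $\kappa:\Omega'\times\Omega'\to\mathbb{R}$ with $\sum_{i,j=1}^m c_ic_j\kappa(x_i,x_j)\ge0$ for all $m\in\mathbb{N}$, $c_i\in\mathbb{R}$, $x_i\in\Omega'$. Its RKHS $\mathcal{K}$ is the completion of the span of the functions $\kappa(\cdot,x)$, $x\in\Omega'$, under the inner product determined by $\langle\kappa(\cdot,x),\kappa(\cdot,y)\rangle=\kappa(x,y)$. A feature map for $\kappa$ is a map $\psi:\Omega'\to\mathcal{K}$ with $\kappa(x,y)=\langle\psi(x),\psi(y)\rangle_{\mathcal{K}}$ for all $x,y\in\Omega'$. Let $\mathbb{P}_\kappa(\Omega')=\{\rho\in\mathbb{P}(\Omega'):\int_{\Omega'}\sqrt{\kappa(x,x)}\,\rho(dx)<+\infty\}$, and let $\rho_\kappa=\int_{\Omega'}\kappa(x,\cdot)\,\rho(dx)\in\mathcal{K}$ be the kernel mean embedding. Then $\mathrm{MMD}_\kappa(\rho,\rho')=\|\rho_\kappa-\rho'_\kappa\|_{\mathcal{K}}$ if $\rho,\rho'\in\mathbb{P}_\kappa(\Omega')$, and $+\infty$ otherwise.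
   Formalization: Adds that at least one of F_♯μ, G_♯μ lies in P_κ(Ω') (otherwise MMD is +∞ while the right side is finite, so the claim fails), and that x↦κ(x,y) is Borel measurable for each y, so that the kernel mean embedding is defined. *)

theory Defs
  imports "HOL-Probability.Probability" "HOL-Probability.Essential_Supremum"
begin

definition mercer_kernel :: "'a set \<Rightarrow> ('a \<Rightarrow> 'a \<Rightarrow> real) \<Rightarrow> bool" where
  "mercer_kernel X \<kappa> \<longleftrightarrow>
     (\<forall>x\<in>X. \<forall>y\<in>X. \<kappa> x y = \<kappa> y x) \<and>
     (\<forall>(m::nat) (c :: nat \<Rightarrow> real) (x :: nat \<Rightarrow> 'a).
        (\<forall>i<m. x i \<in> X) \<longrightarrow> (\<Sum>i<m. \<Sum>j<m. c i * c j * \<kappa> (x i) (x j)) \<ge> 0)"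

section \<open>The reproducing kernel Hilbert space\<close>

text \<open>
  Real functions on \<open>X\<close> are represented by total functions that vanish off \<open>X\<close>, so that
  equality of functions on \<open>X\<close> is HOL equality.
\<close>

definition kernel_comb :: "'a set \<Rightarrow> ('a \<Rightarrow> 'a \<Rightarrow> real) \<Rightarrow> 'a set \<Rightarrow> ('a \<Rightarrow> real) \<Rightarrow> 'a \<Rightarrow> real" where
  "kernel_comb X \<kappa> A c = (\<lambda>z. if z \<in> X then (\<Sum>x\<in>A. c x * \<kappa> z x) else 0)"

definition kernel_span :: "'a set \<Rightarrow> ('a \<Rightarrow> 'a \<Rightarrow> real) \<Rightarrow> ('a \<Rightarrow> real) set" where
  "kernel_span X \<kappa> = {kernel_comb X \<kappa> A c |A c. finite A \<and> A \<subseteq> X}"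

text \<open>
  The bilinear extension of \<open>\<langle>\<kappa>(\<cdot>,x), \<kappa>(\<cdot>,y)\<rangle> = \<kappa>(x,y)\<close>; the value does not depend on the chosen
  representations (lemma \<open>span_inner_eq\<close> below).
\<close>

definition span_inner ::
  "'a set \<Rightarrow> ('a \<Rightarrow> 'a \<Rightarrow> real) \<Rightarrow> ('a \<Rightarrow> real) \<Rightarrow> ('a \<Rightarrow> real) \<Rightarrow> real" where
  "span_inner X \<kappa> f g =
     (THE r. \<exists>A a B b. finite A \<and> A \<subseteq> X \<and> f = kernel_comb X \<kappa> A a \<and>
                       finite B \<and> B \<subseteq> X \<and> g = kernel_comb X \<kappa> B b \<and>
                       r = (\<Sum>x\<in>A. \<Sum>y\<in>B. a x * b y * \<kappa> x y))"

definition span_norm :: "'a set \<Rightarrow> ('a \<Rightarrow> 'a \<Rightarrow> real) \<Rightarrow> ('a \<Rightarrow> real) \<Rightarrow> real" where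
  "span_norm X \<kappa> f = sqrt (span_inner X \<kappa> f f)"

text \<open>
  The completion of the span is realised, as usual, as a space of functions: norm-Cauchy sequences
  in the span converge pointwise, and the abstract limit is identified with the pointwise limit.
  Two Cauchy sequences with the same pointwise limit are equivalent in the completion, so that the
  inner product below is well defined (lemma \<open>rkhs_inner_eq\<close>).
\<close>

definition represents ::
  "'a set \<Rightarrow> ('a \<Rightarrow> 'a \<Rightarrow> real) \<Rightarrow> (nat \<Rightarrow> 'a \<Rightarrow> real) \<Rightarrow> ('a \<Rightarrow> real) \<Rightarrow> bool" where
  "represents X \<kappa> F f \<longleftrightarrow>
     (\<forall>n. F n \<in> kernel_span X \<kappa>) \<and>
     (\<forall>e>0. \<exists>N. \<forall>m\<ge>N. \<forall>n\<ge>N. span_norm X \<kappa> (\<lambda>z. F m z - F n z) < e) \<and>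
     (\<forall>z. (\<lambda>n. F n z) \<longlonglongrightarrow> f z)"

definition rkhs :: "'a set \<Rightarrow> ('a \<Rightarrow> 'a \<Rightarrow> real) \<Rightarrow> ('a \<Rightarrow> real) set" where
  "rkhs X \<kappa> = {f. \<exists>F. represents X \<kappa> F f}"

definition rkhs_inner ::
  "'a set \<Rightarrow> ('a \<Rightarrow> 'a \<Rightarrow> real) \<Rightarrow> ('a \<Rightarrow> real) \<Rightarrow> ('a \<Rightarrow> real) \<Rightarrow> real" where
  "rkhs_inner X \<kappa> f g =
     (THE r. \<exists>F G. represents X \<kappa> F f \<and> represents X \<kappa> G g \<and>
                   (\<lambda>n. span_inner X \<kappa> (F n) (G n)) \<longlonglongrightarrow> r)"

definition rkhs_norm :: "'a set \<Rightarrow> ('a \<Rightarrow> 'a \<Rightarrow> real) \<Rightarrow> ('a \<Rightarrow> real) \<Rightarrow> real" where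
  "rkhs_norm X \<kappa> f = sqrt (rkhs_inner X \<kappa> f f)"

definition feature_map ::
  "'a set \<Rightarrow> ('a \<Rightarrow> 'a \<Rightarrow> real) \<Rightarrow> ('a \<Rightarrow> 'a \<Rightarrow> real) \<Rightarrow> bool" where
  "feature_map X \<kappa> \<psi> \<longleftrightarrow>
     (\<forall>x\<in>X. \<psi> x \<in> rkhs X \<kappa>) \<and>
     (\<forall>x\<in>X. \<forall>y\<in>X. \<kappa> x y = rkhs_inner X \<kappa> (\<psi> x) (\<psi> y))"

section \<open>Maximum mean discrepancy\<close>

definition borel_probs :: "'a::topological_space set \<Rightarrow> 'a measure set" where
  "borel_probs X = {\<rho>. sets \<rho> = sets (restrict_space borel X) \<and> prob_space \<rho>}"

definition kernel_probs ::
  "'a::topological_space set \<Rightarrow> ('a \<Rightarrow> 'a \<Rightarrow> real) \<Rightarrow> 'a measure set" where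
  "kernel_probs X \<kappa> = {\<rho> \<in> borel_probs X. integrable \<rho> (\<lambda>x. sqrt (\<kappa> x x))}"

text \<open>
  The integral of \<open>x \<mapsto> \<kappa>(x,\<cdot>)\<close> as an element of the function space \<open>rkhs X \<kappa>\<close>; by the
  reproducing property its value at \<open>z\<close> is the integral of \<open>\<kappa>(\<cdot>,z)\<close>.
\<close>

definition mean_embedding ::
  "'a::topological_space set \<Rightarrow> ('a \<Rightarrow> 'a \<Rightarrow> real) \<Rightarrow> 'a measure \<Rightarrow> 'a \<Rightarrow> real" where
  "mean_embedding X \<kappa> \<rho> = (\<lambda>z. if z \<in> X then (LINT x|\<rho>. \<kappa> x z) else 0)"

definition MMD ::
  "'a::topological_space set \<Rightarrow> ('a \<Rightarrow> 'a \<Rightarrow> real) \<Rightarrow> 'a measure \<Rightarrow> 'a measure \<Rightarrow> ennreal" where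
  "MMD X \<kappa> \<rho> \<rho>' =
     (if \<rho> \<in> kernel_probs X \<kappa> \<and> \<rho>' \<in> kernel_probs X \<kappa>
      then ennreal (rkhs_norm X \<kappa> (\<lambda>z. mean_embedding X \<kappa> \<rho> z - mean_embedding X \<kappa> \<rho>' z))
      else \<infinity>)"

section \<open>Lebesgue spaces with exponent in \<open>[1,\<infinity>]\<close>\<close>

definition Lp_norm :: "ennreal \<Rightarrow> 'a measure \<Rightarrow> ('a \<Rightarrow> 'b::real_normed_vector) \<Rightarrow> ennreal" where
  "Lp_norm p M f =
     (if p = \<infinity> then esssup M (\<lambda>x. ennreal (norm (f x)))
      else let I = (\<integral>\<^sup>+x. ennreal (norm (f x) powr enn2real p) \<partial>M)
           in if I = \<infinity> then \<infinity> else ennreal (enn2real I powr (1 / enn2real p)))"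

text \<open>
  Functions with values in a subset \<open>Y\<close> (everywhere on the underlying space of \<open>M\<close>); elements are
  functions rather than classes modulo null sets.
\<close>

definition Lp_space ::
  "ennreal \<Rightarrow> 'a measure \<Rightarrow> 'b::real_normed_vector set \<Rightarrow> ('a \<Rightarrow> 'b) set" where
  "Lp_space p M Y = {f \<in> measurable M (restrict_space borel Y). Lp_norm p M f < \<infinity>}"

section \<open>Well-definedness of the inner products\<close>

lemma mercer_kernel_sym: "mercer_kernel X \<kappa> \<Longrightarrow> x \<in> X \<Longrightarrow> y \<in> X \<Longrightarrow> \<kappa> x y = \<kappa> y x"
  by (simp add: mercer_kernel_def)

lemma mercer_kernel_nonneg:
  assumes "mercer_kernel X \<kappa>" "finite A" "A \<subseteq> X"
  shows "(\<Sum>x\<in>A. \<Sum>y\<in>A. c x * c y * \<kappa> x y) \<ge> 0"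
proof -
  obtain h where h: "bij_betw h {..<card A} A"
    using ex_bij_betw_nat_finite[OF assms(2)] by (auto simp: atLeast0LessThan)
  have hX: "\<forall>i<card A. h i \<in> X"
    using h assms(3) by (auto simp: bij_betw_def)
  have "(\<Sum>x\<in>A. \<Sum>y\<in>A. c x * c y * \<kappa> x y) =
        (\<Sum>x\<in>A. \<Sum>j<card A. c x * c (h j) * \<kappa> x (h j))"
    by (intro sum.cong refl sum.reindex_bij_betw[OF h, symmetric])
  also have "\<dots> = (\<Sum>i<card A. \<Sum>j<card A. c (h i) * c (h j) * \<kappa> (h i) (h j))"
    by (rule sum.reindex_bij_betw[OF h, symmetric])
  also have "\<dots> \<ge> 0"
    using assms(1) unfolding mercer_kernel_def
    by (elim conjE allE[of _ "card A"] allE[of _ "\<lambda>i. c (h i)"] allE[of _ h]) (use hX in blast)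
  finally show ?thesis .
qed

lemma kernel_comb_pairing:
  assumes "mercer_kernel X \<kappa>" "finite A" "A \<subseteq> X" "finite B" "B \<subseteq> X"
  shows "(\<Sum>x\<in>A. \<Sum>y\<in>B. a x * b y * \<kappa> x y) = (\<Sum>y\<in>B. b y * kernel_comb X \<kappa> A a y)"
    and "(\<Sum>x\<in>A. \<Sum>y\<in>B. a x * b y * \<kappa> x y) = (\<Sum>x\<in>A. a x * kernel_comb X \<kappa> B b x)"
proof -
  have "(\<Sum>x\<in>A. \<Sum>y\<in>B. a x * b y * \<kappa> x y) = (\<Sum>y\<in>B. \<Sum>x\<in>A. a x * b y * \<kappa> x y)"
    by (rule sum.swap)
  also have "\<dots> = (\<Sum>y\<in>B. b y * kernel_comb X \<kappa> A a y)"
  proof (rule sum.cong[OF refl])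
    fix y assume "y \<in> B"
    then have "y \<in> X" using assms by auto
    moreover have "\<kappa> x y = \<kappa> y x" if "x \<in> A" for x
      using assms that \<open>y \<in> X\<close> by (auto intro: mercer_kernel_sym)
    ultimately show "(\<Sum>x\<in>A. a x * b y * \<kappa> x y) = b y * kernel_comb X \<kappa> A a y"
      by (auto simp: kernel_comb_def sum_distrib_left mult_ac intro!: sum.cong)
  qed
  finally show "(\<Sum>x\<in>A. \<Sum>y\<in>B. a x * b y * \<kappa> x y) = (\<Sum>y\<in>B. b y * kernel_comb X \<kappa> A a y)" .
  show "(\<Sum>x\<in>A. \<Sum>y\<in>B. a x * b y * \<kappa> x y) = (\<Sum>x\<in>A. a x * kernel_comb X \<kappa> B b x)"
    using assms by (auto simp: kernel_comb_def sum_distrib_left mult_ac intro!: sum.cong)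
qed

lemma span_inner_eq:
  assumes "mercer_kernel X \<kappa>" "finite A" "A \<subseteq> X" "finite B" "B \<subseteq> X"
  shows "span_inner X \<kappa> (kernel_comb X \<kappa> A a) (kernel_comb X \<kappa> B b) =
         (\<Sum>x\<in>A. \<Sum>y\<in>B. a x * b y * \<kappa> x y)"
  unfolding span_inner_def
proof (rule the_equality)
  show "\<exists>A' a' B' b'. finite A' \<and> A' \<subseteq> X \<and> kernel_comb X \<kappa> A a = kernel_comb X \<kappa> A' a' \<and>
          finite B' \<and> B' \<subseteq> X \<and> kernel_comb X \<kappa> B b = kernel_comb X \<kappa> B' b' \<and>
          (\<Sum>x\<in>A. \<Sum>y\<in>B. a x * b y * \<kappa> x y) = (\<Sum>x\<in>A'. \<Sum>y\<in>B'. a' x * b' y * \<kappa> x y)"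
    using assms by blast
next
  fix r
  assume "\<exists>A' a' B' b'. finite A' \<and> A' \<subseteq> X \<and> kernel_comb X \<kappa> A a = kernel_comb X \<kappa> A' a' \<and>
          finite B' \<and> B' \<subseteq> X \<and> kernel_comb X \<kappa> B b = kernel_comb X \<kappa> B' b' \<and>
          r = (\<Sum>x\<in>A'. \<Sum>y\<in>B'. a' x * b' y * \<kappa> x y)"
  then obtain A' a' B' b' where *: "finite A'" "A' \<subseteq> X" "finite B'" "B' \<subseteq> X"
    "kernel_comb X \<kappa> A a = kernel_comb X \<kappa> A' a'"
    "kernel_comb X \<kappa> B b = kernel_comb X \<kappa> B' b'"
    "r = (\<Sum>x\<in>A'. \<Sum>y\<in>B'. a' x * b' y * \<kappa> x y)" by blast
  have "r = (\<Sum>y\<in>B'. b' y * kernel_comb X \<kappa> A a y)"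
    using * kernel_comb_pairing(1)[OF assms(1) *(1,2,3,4)] by simp
  also have "\<dots> = (\<Sum>x\<in>A. \<Sum>y\<in>B'. a x * b' y * \<kappa> x y)"
    using kernel_comb_pairing(1)[OF assms(1,2,3) *(3,4)] by simp
  also have "\<dots> = (\<Sum>x\<in>A. a x * kernel_comb X \<kappa> B b x)"
    using kernel_comb_pairing(2)[OF assms(1,2,3) *(3,4)] * by simp
  also have "\<dots> = (\<Sum>x\<in>A. \<Sum>y\<in>B. a x * b y * \<kappa> x y)"
    using kernel_comb_pairing(2)[OF assms] by simp
  finally show "r = (\<Sum>x\<in>A. \<Sum>y\<in>B. a x * b y * \<kappa> x y)" .
qed

lemma span_inner_comb_right:
  assumes "mercer_kernel X \<kappa>" "f \<in> kernel_span X \<kappa>" "finite B" "B \<subseteq> X"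
  shows "span_inner X \<kappa> f (kernel_comb X \<kappa> B b) = (\<Sum>y\<in>B. b y * f y)"
proof -
  obtain A a where *: "finite A" "A \<subseteq> X" "f = kernel_comb X \<kappa> A a"
    using assms(2) by (auto simp: kernel_span_def)
  show ?thesis
    unfolding *(3) span_inner_eq[OF assms(1) *(1,2) assms(3,4)]
    by (rule kernel_comb_pairing(1)[OF assms(1) *(1,2) assms(3,4)])
qed

lemma span_inner_sym:
  assumes "mercer_kernel X \<kappa>" "f \<in> kernel_span X \<kappa>" "g \<in> kernel_span X \<kappa>"
  shows "span_inner X \<kappa> f g = span_inner X \<kappa> g f"
proof -
  obtain A a B b where *: "finite A" "A \<subseteq> X" "f = kernel_comb X \<kappa> A a"
    "finite B" "B \<subseteq> X" "g = kernel_comb X \<kappa> B b"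
    using assms by (auto simp: kernel_span_def)
  then show ?thesis
    using kernel_comb_pairing(2)[OF assms(1) *(1,2,4,5)] span_inner_comb_right[OF assms(1,3) *(1,2)]
    by (simp add: span_inner_eq assms(1))
qed

lemma span_inner_nonneg:
  assumes "mercer_kernel X \<kappa>" "f \<in> kernel_span X \<kappa>"
  shows "span_inner X \<kappa> f f \<ge> 0"
proof -
  obtain A a where *: "finite A" "A \<subseteq> X" "f = kernel_comb X \<kappa> A a"
    using assms(2) by (auto simp: kernel_span_def)
  show ?thesis
    unfolding *(3) span_inner_eq[OF assms(1) *(1,2) *(1,2)]
    by (rule mercer_kernel_nonneg[OF assms(1) *(1,2)])
qed

lemma kernel_span_lincomb:
  assumes "f \<in> kernel_span X \<kappa>" "g \<in> kernel_span X \<kappa>"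
  shows "(\<lambda>z. s * f z + t * g z) \<in> kernel_span X \<kappa>"
proof -
  obtain A a where A: "finite A" "A \<subseteq> X" "f = kernel_comb X \<kappa> A a"
    using assms(1) by (auto simp: kernel_span_def)
  obtain B b where B: "finite B" "B \<subseteq> X" "g = kernel_comb X \<kappa> B b"
    using assms(2) by (auto simp: kernel_span_def)
  define c where "c x = s * (if x \<in> A then a x else 0) + t * (if x \<in> B then b x else 0)" for x
  have "(\<lambda>z. s * f z + t * g z) = kernel_comb X \<kappa> (A \<union> B) c"
  proof
    fix z
    have "(\<Sum>x\<in>A. a x * \<kappa> z x) = (\<Sum>x\<in>A \<union> B. (if x \<in> A then a x else 0) * \<kappa> z x)"
      using A(1) B(1) by (intro sum.mono_neutral_cong_left) auto
    moreover have "(\<Sum>x\<in>B. b x * \<kappa> z x) = (\<Sum>x\<in>A \<union> B. (if x \<in> B then b x else 0) * \<kappa> z x)"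
      using A(1) B(1) by (intro sum.mono_neutral_cong_left) auto
    moreover have "(\<Sum>x\<in>A \<union> B. c x * \<kappa> z x) =
        s * (\<Sum>x\<in>A \<union> B. (if x \<in> A then a x else 0) * \<kappa> z x) +
        t * (\<Sum>x\<in>A \<union> B. (if x \<in> B then b x else 0) * \<kappa> z x)"
      unfolding c_def sum_distrib_left sum.distrib[symmetric]
      by (intro sum.cong refl) (simp only: distrib_right mult.assoc)
    ultimately show "s * f z + t * g z = kernel_comb X \<kappa> (A \<union> B) c z"
      unfolding A(3) B(3) kernel_comb_def by simp
  qed
  moreover have "finite (A \<union> B)" "A \<union> B \<subseteq> X"
    using A(1,2) B(1,2) by auto
  ultimately show ?thesis
    unfolding kernel_span_def by blast
qed

lemma kernel_span_diff:
  assumes "f \<in> kernel_span X \<kappa>" "g \<in> kernel_span X \<kappa>"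
  shows "(\<lambda>z. f z - g z) \<in> kernel_span X \<kappa>"
  using kernel_span_lincomb[OF assms, of 1 "-1"] by simp

lemma span_inner_lincomb_left:
  assumes "mercer_kernel X \<kappa>" "f \<in> kernel_span X \<kappa>" "g \<in> kernel_span X \<kappa>" "h \<in> kernel_span X \<kappa>"
  shows "span_inner X \<kappa> (\<lambda>z. s * f z + t * g z) h = s * span_inner X \<kappa> f h + t * span_inner X \<kappa> g h"
proof -
  obtain B b where *: "finite B" "B \<subseteq> X" "h = kernel_comb X \<kappa> B b"
    using assms by (auto simp: kernel_span_def)
  show ?thesis
    by (simp add: * span_inner_comb_right[OF assms(1) _ *(1,2)] kernel_span_lincomb assms
          sum_distrib_left sum.distrib algebra_simps)
qed

lemma span_inner_diff_left:
  assumes "mercer_kernel X \<kappa>" "f \<in> kernel_span X \<kappa>" "g \<in> kernel_span X \<kappa>" "h \<in> kernel_span X \<kappa>"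
  shows "span_inner X \<kappa> (\<lambda>z. f z - g z) h = span_inner X \<kappa> f h - span_inner X \<kappa> g h"
  using span_inner_lincomb_left[OF assms, of 1 "-1"] by simp

lemma span_inner_diff_right:
  assumes "mercer_kernel X \<kappa>" "f \<in> kernel_span X \<kappa>" "g \<in> kernel_span X \<kappa>" "h \<in> kernel_span X \<kappa>"
  shows "span_inner X \<kappa> h (\<lambda>z. f z - g z) = span_inner X \<kappa> h f - span_inner X \<kappa> h g"
  using span_inner_diff_left[OF assms] assms
  by (simp add: span_inner_sym[OF assms(1,4)] kernel_span_diff)

lemma span_norm_nonneg: 
  assumes "mercer_kernel X \<kappa>" "f \<in> kernel_span X \<kappa>"
  shows "span_norm X \<kappa> f \<ge> 0"
  using assms by (simp add: span_norm_def span_inner_nonneg)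

lemma span_norm_power2:
  assumes "mercer_kernel X \<kappa>" "f \<in> kernel_span X \<kappa>"
  shows "(span_norm X \<kappa> f)\<^sup>2 = span_inner X \<kappa> f f"
  using assms by (simp add: span_norm_def span_inner_nonneg)

lemma span_inner_Cauchy_Schwarz:
  assumes "mercer_kernel X \<kappa>" "f \<in> kernel_span X \<kappa>" "g \<in> kernel_span X \<kappa>"
  shows "\<bar>span_inner X \<kappa> f g\<bar> \<le> span_norm X \<kappa> f * span_norm X \<kappa> g"
proof -
  let ?I = "span_inner X \<kappa>"
  have expand: "?I (\<lambda>z. s * f z + t * g z) (\<lambda>z. s * f z + t * g z) =
      s\<^sup>2 * ?I f f + 2 * s * t * ?I f g + t\<^sup>2 * ?I g g" for s t
  proof -
    let ?h = "\<lambda>z. s * f z + t * g z"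
    have h: "?h \<in> kernel_span X \<kappa>"
      using assms by (simp add: kernel_span_lincomb)
    have "?I ?h ?h = s * ?I f ?h + t * ?I g ?h"
      using assms h by (simp add: span_inner_lincomb_left)
    also have "?I f ?h = s * ?I f f + t * ?I f g"
      using span_inner_lincomb_left[OF assms(1) assms(2,3) assms(2), of s t]
        span_inner_sym[OF assms(1,2) h] span_inner_sym[OF assms] by simp
    also have "?I g ?h = s * ?I f g + t * ?I g g"
      using span_inner_lincomb_left[OF assms(1) assms(2,3) assms(3), of s t]
        span_inner_sym[OF assms(1,3) h] by simp
    finally show ?thesis
      by (simp add: power2_eq_square algebra_simps)
  qed
  have pos: "s\<^sup>2 * ?I f f + 2 * s * t * ?I f g + t\<^sup>2 * ?I g g \<ge> 0" for s t
    using span_inner_nonneg[OF assms(1) kernel_span_lincomb[OF assms(2,3), of s t]] expand by simp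
  have ff: "?I f f \<ge> 0" and gg: "?I g g \<ge> 0"
    using assms by (simp_all add: span_inner_nonneg)
  have "(?I f g)\<^sup>2 \<le> ?I f f * ?I g g"
  proof (cases "?I g g = 0")
    case True
    have "?I f g = 0"
    proof (rule ccontr)
      assume nz: "?I f g \<noteq> 0"
      show False
        using pos[of 1 "- (?I f f + 1) / (2 * ?I f g)"] True nz ff by (simp add: field_simps)
    qed
    then show ?thesis using True by simp
  next
    case False
    then have "?I g g > 0" using gg by simp
    moreover have "(?I g g)\<^sup>2 * ?I f f + 2 * ?I g g * (- ?I f g) * ?I f g + (- ?I f g)\<^sup>2 * ?I g g \<ge> 0"
      by (rule pos)
    then have "?I g g * (?I f f * ?I g g - (?I f g)\<^sup>2) \<ge> 0"
      by (simp add: power2_eq_square algebra_simps)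
    ultimately show ?thesis
      by (simp add: zero_le_mult_iff)
  qed
  then have "sqrt ((?I f g)\<^sup>2) \<le> sqrt (?I f f * ?I g g)"
    by (rule real_sqrt_le_mono)
  then show ?thesis
    by (simp add: span_norm_def real_sqrt_mult)
qed

lemma represents_bounded:
  assumes "mercer_kernel X \<kappa>" "represents X \<kappa> F f"
  obtains C where "C > 0" "\<And>n. span_norm X \<kappa> (F n) \<le> C"
proof -
  have F: "F n \<in> kernel_span X \<kappa>" for n using assms(2) by (simp add: represents_def)
  obtain N where N: "span_norm X \<kappa> (\<lambda>z. F m z - F n z) < 1" if "m \<ge> N" "n \<ge> N" for m n
    using assms(2) unfolding represents_def by (meson zero_less_one)
  have *: "span_norm X \<kappa> (F n) \<le> 1 + span_norm X \<kappa> (F N)" if "n \<ge> N" for n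
  proof -
    let ?u = "span_norm X \<kappa> (F n)" and ?v = "span_norm X \<kappa> (F N)"
    let ?d = "\<lambda>z. F n z - F N z"
    have "?u\<^sup>2 = span_inner X \<kappa> ?d (F n) + span_inner X \<kappa> (F N) (F n)"
      using assms(1) F by (simp add: span_norm_power2 span_inner_diff_left)
    also have "\<dots> \<le> span_norm X \<kappa> ?d * ?u + ?v * ?u"
      using span_inner_Cauchy_Schwarz[OF assms(1) kernel_span_diff[OF F F] F, of n N n]
        span_inner_Cauchy_Schwarz[OF assms(1) F F, of N n] by linarith
    also have "\<dots> \<le> 1 * ?u + ?v * ?u"
      using N[OF that, of N] span_norm_nonneg[OF assms(1) F, of n]
      by (intro add_mono mult_right_mono) auto
    finally have "?u * ?u \<le> (1 + ?v) * ?u"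
      by (simp add: power2_eq_square algebra_simps)
    then show ?thesis
      using span_norm_nonneg[OF assms(1) F, of n] span_norm_nonneg[OF assms(1) F, of N]
      by (cases "?u = 0") (auto simp: mult_le_cancel_right)
  qed
  define C where "C = 1 + span_norm X \<kappa> (F N) + (\<Sum>n<N. span_norm X \<kappa> (F n))"
  have nn: "span_norm X \<kappa> (F n) \<ge> 0" for n using span_norm_nonneg[OF assms(1) F] .
  show ?thesis
  proof (rule that[of C])
    show "C > 0" unfolding C_def using nn by (simp add: add_pos_nonneg sum_nonneg)
    fix n
    show "span_norm X \<kappa> (F n) \<le> C"
    proof (cases "n \<ge> N")
      case True
      then show ?thesis using *[OF True] nn sum_nonneg[of "{..<N}" "\<lambda>n. span_norm X \<kappa> (F n)"]
        by (simp add: C_def)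
    next
      case False
      then have "span_norm X \<kappa> (F n) \<le> (\<Sum>n<N. span_norm X \<kappa> (F n))"
        using nn by (intro member_le_sum) auto
      then show ?thesis using nn[of N] by (simp add: C_def)
    qed
  qed
qed

lemma represents_inner_tendsto_0:
  assumes "mercer_kernel X \<kappa>" "represents X \<kappa> F f" "represents X \<kappa> F' f" "represents X \<kappa> G g"
  shows "(\<lambda>n. span_inner X \<kappa> (F n) (G n) - span_inner X \<kappa> (F' n) (G n)) \<longlonglongrightarrow> 0"
proof -
  have F: "F n \<in> kernel_span X \<kappa>" and F': "F' n \<in> kernel_span X \<kappa>" and G: "G n \<in> kernel_span X \<kappa>"
    for n using assms by (simp_all add: represents_def)
  let ?D = "\<lambda>n z. F n z - F' n z"
  have D: "?D n \<in> kernel_span X \<kappa>" for n using F F' by (rule kernel_span_diff)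
  have Dlim: "(\<lambda>n. ?D n z) \<longlonglongrightarrow> 0" for z
    using tendsto_diff[of "\<lambda>n. F n z" "f z" sequentially "\<lambda>n. F' n z" "f z"] assms(2,3)
    by (simp add: represents_def)
  obtain C1 where C1: "C1 > 0" "\<And>n. span_norm X \<kappa> (F n) \<le> C1"
    using represents_bounded[OF assms(1,2)] by blast
  obtain C2 where C2: "C2 > 0" "\<And>n. span_norm X \<kappa> (F' n) \<le> C2"
    using represents_bounded[OF assms(1,3)] by blast
  have "\<exists>no. \<forall>n\<ge>no. \<bar>span_inner X \<kappa> (?D n) (G n)\<bar> < e" if "e > 0" for e
  proof -
    define d' where "d' = e / (2 * (C1 + C2))"
    have d': "d' > 0"
      using that C1 C2 by (simp add: d'_def)
    obtain N where N: "\<And>m n. m \<ge> N \<Longrightarrow> n \<ge> N \<Longrightarrow> span_norm X \<kappa> (\<lambda>z. G m z - G n z) < d'"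
      using assms(4) d' unfolding represents_def by meson
    obtain B b where B: "finite B" "B \<subseteq> X" "G N = kernel_comb X \<kappa> B b"
      using G[of N] by (auto simp: kernel_span_def)
    have "(\<lambda>n. \<Sum>y\<in>B. b y * ?D n y) \<longlonglongrightarrow> (\<Sum>y\<in>B. b y * 0)"
      by (intro tendsto_intros Dlim)
    then have lim: "(\<lambda>n. span_inner X \<kappa> (?D n) (G N)) \<longlonglongrightarrow> 0"
      using span_inner_comb_right[OF assms(1) D B(1,2)] by (simp add: B(3))
    have "e / 2 > 0" using that by simp
    from LIMSEQ_D[OF lim this] obtain M
      where M: "\<And>n. n \<ge> M \<Longrightarrow> \<bar>span_inner X \<kappa> (?D n) (G N)\<bar> < e / 2"
      by auto
    show ?thesis
    proof (intro exI[of _ "max M N"] allI impI)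
      fix n assume n: "n \<ge> max M N"
      let ?g = "\<lambda>z. G n z - G N z"
      have g: "?g \<in> kernel_span X \<kappa>" by (rule kernel_span_diff[OF G G])
      have "span_norm X \<kappa> ?g \<le> d'" using N[of n N] n by simp
      have 1: "\<bar>span_inner X \<kappa> (F n) ?g\<bar> \<le> C1 * d'"
        using span_inner_Cauchy_Schwarz[OF assms(1) F g, of n] C1 \<open>span_norm X \<kappa> ?g \<le> d'\<close>
          span_norm_nonneg[OF assms(1) g]
        by (meson less_imp_le mult_mono order_trans)
      have 2: "\<bar>span_inner X \<kappa> (F' n) ?g\<bar> \<le> C2 * d'"
        using span_inner_Cauchy_Schwarz[OF assms(1) F' g, of n] C2 \<open>span_norm X \<kappa> ?g \<le> d'\<close>
          span_norm_nonneg[OF assms(1) g]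
        by (meson less_imp_le mult_mono order_trans)
      have 3: "C1 * d' + C2 * d' = e / 2"
      proof -
        have "C1 + C2 > 0" using C1(1) C2(1) by simp
        then have "(C1 + C2) * d' = e / 2"
          unfolding d'_def by (metis less_irrefl nonzero_mult_div_cancel_left mult.commute
            mult_divide_mult_cancel_right times_divide_eq_right)
        then show ?thesis by (simp add: distrib_right)
      qed
      have "span_inner X \<kappa> (?D n) (G n) =
          span_inner X \<kappa> (?D n) (G N) + span_inner X \<kappa> (F n) ?g - span_inner X \<kappa> (F' n) ?g"
        using assms(1) F F' G D g
        by (simp add: span_inner_diff_left span_inner_diff_right)
      then show "\<bar>span_inner X \<kappa> (?D n) (G n)\<bar> < e"
        using 1 2 3 M[of n] n by linarith
    qed
  qed
  then have "(\<lambda>n. span_inner X \<kappa> (?D n) (G n)) \<longlonglongrightarrow> 0"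
    by (intro LIMSEQ_I) simp
  then show ?thesis
    using assms(1) F F' G by (simp add: span_inner_diff_left)
qed

lemma represents_inner_convergent:
  assumes "mercer_kernel X \<kappa>" "represents X \<kappa> F f" "represents X \<kappa> G g"
  shows "convergent (\<lambda>n. span_inner X \<kappa> (F n) (G n))"
proof -
  have F: "F n \<in> kernel_span X \<kappa>" and G: "G n \<in> kernel_span X \<kappa>"
    for n using assms by (simp_all add: represents_def)
  obtain C where C: "C > 0" "\<And>n. span_norm X \<kappa> (F n) \<le> C"
    using represents_bounded[OF assms(1,2)] by blast
  obtain K where K: "K > 0" "\<And>n. span_norm X \<kappa> (G n) \<le> K"
    using represents_bounded[OF assms(1,3)] by blast
  have "Cauchy (\<lambda>n. span_inner X \<kappa> (F n) (G n))"
  proof (rule CauchyI)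
    fix e :: real assume e: "e > 0"
    obtain N1 where N1: "\<And>m n. m \<ge> N1 \<Longrightarrow> n \<ge> N1 \<Longrightarrow> span_norm X \<kappa> (\<lambda>z. F m z - F n z) < e / (2 * K)"
      using assms(2) e K unfolding represents_def by (metis divide_pos_pos mult_pos_pos zero_less_numeral)
    obtain N2 where N2: "\<And>m n. m \<ge> N2 \<Longrightarrow> n \<ge> N2 \<Longrightarrow> span_norm X \<kappa> (\<lambda>z. G m z - G n z) < e / (2 * C)"
      using assms(3) e C unfolding represents_def by (metis divide_pos_pos mult_pos_pos zero_less_numeral)
    show "\<exists>M. \<forall>m\<ge>M. \<forall>n\<ge>M. norm (span_inner X \<kappa> (F m) (G m) - span_inner X \<kappa> (F n) (G n)) < e"
    proof (intro exI[of _ "max N1 N2"] allI impI)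
      fix m n assume mn: "m \<ge> max N1 N2" "n \<ge> max N1 N2"
      let ?f = "\<lambda>z. F m z - F n z" and ?g = "\<lambda>z. G m z - G n z"
      have f: "?f \<in> kernel_span X \<kappa>" and g: "?g \<in> kernel_span X \<kappa>"
        by (rule kernel_span_diff[OF F F], rule kernel_span_diff[OF G G])
      have "\<bar>span_inner X \<kappa> ?f (G m)\<bar> \<le> span_norm X \<kappa> ?f * K"
        using span_inner_Cauchy_Schwarz[OF assms(1) f G, of m] K(2)[of m] span_norm_nonneg[OF assms(1) f]
        by (meson mult_left_mono order_trans)
      also have "\<dots> < e / (2 * K) * K"
        using N1[of m n] mn K(1) by (intro mult_strict_right_mono) auto
      finally have 1: "\<bar>span_inner X \<kappa> ?f (G m)\<bar> < e / 2" using K(1) by simp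
      have "\<bar>span_inner X \<kappa> (F n) ?g\<bar> \<le> C * span_norm X \<kappa> ?g"
        using span_inner_Cauchy_Schwarz[OF assms(1) F g, of n] C(2)[of n] span_norm_nonneg[OF assms(1) g]
        by (meson mult_right_mono order_trans)
      also have "\<dots> < C * (e / (2 * C))"
        using N2[of m n] mn C(1) by (intro mult_strict_left_mono) auto
      finally have 2: "\<bar>span_inner X \<kappa> (F n) ?g\<bar> < e / 2" using C(1) by simp
      have "span_inner X \<kappa> (F m) (G m) - span_inner X \<kappa> (F n) (G n) =
          span_inner X \<kappa> ?f (G m) + span_inner X \<kappa> (F n) ?g"
        using assms(1) F G by (simp add: span_inner_diff_left span_inner_diff_right)
      then show "norm (span_inner X \<kappa> (F m) (G m) - span_inner X \<kappa> (F n) (G n)) < e"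
        using 1 2 by simp
    qed
  qed
  then show ?thesis by (simp add: Cauchy_convergent)
qed

lemma rkhs_inner_eq:
  assumes "mercer_kernel X \<kappa>" "represents X \<kappa> F f" "represents X \<kappa> G g"
  shows "(\<lambda>n. span_inner X \<kappa> (F n) (G n)) \<longlonglongrightarrow> rkhs_inner X \<kappa> f g"
proof -
  obtain r where r: "(\<lambda>n. span_inner X \<kappa> (F n) (G n)) \<longlonglongrightarrow> r"
    using represents_inner_convergent[OF assms] by (auto simp: convergent_def)
  have "rkhs_inner X \<kappa> f g = r"
    unfolding rkhs_inner_def
  proof (rule the_equality)
    show "\<exists>F G. represents X \<kappa> F f \<and> represents X \<kappa> G g \<and>
            (\<lambda>n. span_inner X \<kappa> (F n) (G n)) \<longlonglongrightarrow> r"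
      using assms r by blast
  next
    fix r'
    assume "\<exists>F G. represents X \<kappa> F f \<and> represents X \<kappa> G g \<and>
              (\<lambda>n. span_inner X \<kappa> (F n) (G n)) \<longlonglongrightarrow> r'"
    then obtain F' G' where *: "represents X \<kappa> F' f" "represents X \<kappa> G' g"
      "(\<lambda>n. span_inner X \<kappa> (F' n) (G' n)) \<longlonglongrightarrow> r'" by blast
    have F: "F n \<in> kernel_span X \<kappa>" "F' n \<in> kernel_span X \<kappa>"
      and G: "G n \<in> kernel_span X \<kappa>" "G' n \<in> kernel_span X \<kappa>"
      for n using assms * by (simp_all add: represents_def)
    have "(\<lambda>n. span_inner X \<kappa> (F' n) (G' n) +
              (span_inner X \<kappa> (F n) (G' n) - span_inner X \<kappa> (F' n) (G' n)) +
              (span_inner X \<kappa> (G n) (F n) - span_inner X \<kappa> (G' n) (F n))) \<longlonglongrightarrow> r' + 0 + 0"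
      using assms * by (intro tendsto_add represents_inner_tendsto_0) auto
    then have "(\<lambda>n. span_inner X \<kappa> (F n) (G n)) \<longlonglongrightarrow> r'"
      using span_inner_sym[OF assms(1) F(1) G(1)] span_inner_sym[OF assms(1) F(1) G(2)] by simp
    then show "r' = r" using r LIMSEQ_unique by blast
  qed
  then show ?thesis using r by simp
qed

lemma kernel_section_in_span:
  assumes "x \<in> X"
  shows "(\<lambda>z. if z \<in> X then \<kappa> z x else 0) \<in> kernel_span X \<kappa>"
proof -
  have "(\<lambda>z. if z \<in> X then \<kappa> z x else 0) = kernel_comb X \<kappa> {x} (\<lambda>_. 1)"
    by (simp add: kernel_comb_def fun_eq_iff)
  then show ?thesis using assms by (auto simp: kernel_span_def)
qed

lemma represents_const:
  assumes "mercer_kernel X \<kappa>" "f \<in> kernel_span X \<kappa>"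
  shows "represents X \<kappa> (\<lambda>_. f) f"
proof -
  have "span_inner X \<kappa> (\<lambda>z. f z - f z) (\<lambda>z. f z - f z) = 0"
    using assms span_inner_diff_left[OF assms(1,2,2) kernel_span_diff[OF assms(2,2)]] by simp
  then show ?thesis using assms by (simp add: represents_def span_norm_def)
qed

lemma rkhs_reproducing:
  assumes "mercer_kernel X \<kappa>" "f \<in> rkhs X \<kappa>" "x \<in> X"
  shows "rkhs_inner X \<kappa> f (\<lambda>z. if z \<in> X then \<kappa> z x else 0) = f x"
proof -
  obtain F where F: "represents X \<kappa> F f" using assms(2) by (auto simp: rkhs_def)
  let ?k = "\<lambda>z. if z \<in> X then \<kappa> z x else 0"
  have k: "?k = kernel_comb X \<kappa> {x} (\<lambda>_. 1)"
    by (simp add: kernel_comb_def fun_eq_iff)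
  have "span_inner X \<kappa> (F n) ?k = F n x" for n
    using span_inner_comb_right[OF assms(1), of "F n" "{x}" "\<lambda>_. 1"] F assms(3)
    by (simp add: k represents_def)
  then have "(\<lambda>n. F n x) \<longlonglongrightarrow> rkhs_inner X \<kappa> f ?k"
    using rkhs_inner_eq[OF assms(1) F represents_const[OF assms(1) kernel_section_in_span[OF assms(3)]]]
    by simp
  moreover have "(\<lambda>n. F n x) \<longlonglongrightarrow> f x" using F by (simp add: represents_def)
  ultimately show ?thesis by (rule LIMSEQ_unique)
qed

end

theory Submission
  imports Defs
begin

text \<open>
  Write \<open>k\<^sub>x\<close> for the kernel section \<open>\<kappa>(\<cdot>,x)\<close>. The difference \<open>h\<close> of the two mean embeddings
  represents the functional \<open>T f = \<integral> (f \<circ> F - f \<circ> G) d\<mu>\<close>, because \<open>h z = T k\<^sub>z\<close>. By the reproducing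
  property \<open>f (F \<omega>) - f (G \<omega>)\<close> is the inner product of \<open>f\<close> with \<open>k\<^bsub>F \<omega>\<^esub> - k\<^bsub>G \<omega>\<^esub>\<close>, so Cauchy-Schwarz
  bounds \<open>T f\<close> by \<open>\<parallel>f\<parallel>\<close> times the integral of \<open>\<parallel>k\<^bsub>F \<omega>\<^esub> - k\<^bsub>G \<omega>\<^esub>\<parallel>\<close>. Hence \<open>\<parallel>h\<parallel>\<close> is at most that
  integral. A feature map induces the same distances as the kernel sections, since both are given by
  \<open>\<kappa>(x,x) - 2 \<kappa>(x,y) + \<kappa>(y,y)\<close> (\<open>feature_map_dist\<close>). The hypothesis on \<open>\<psi>\<close> therefore bounds the
  integrand by \<open>L(F \<omega>, G \<omega>) \<bar>F \<omega> - G \<omega>\<bar>\<close>, and the Hoelder inequality (\<open>Lp_norm_Holder\<close>) finishes the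
  estimate.

  Two points need care. First, \<open>h\<close> is a function given by its values, and its norm means something only
  once \<open>h\<close> is known to be a pointwise limit of a norm-Cauchy sequence in the span of the sections. Such
  a sequence comes from the variational proof of the Riesz representation theorem: near-minimisers of
  \<open>\<parallel>f\<parallel>\<^sup>2 / 2 - T f\<close> over the span are Cauchy, and they converge pointwise to \<open>z \<mapsto> T k\<^sub>z\<close>
  (\<open>almost_representer_exists\<close>, \<open>rkhs_norm_representer_le\<close>). Only scalar integrals occur:
  the mean embedding is treated as a weak integral of \<open>x \<mapsto> k\<^sub>x\<close>, which may fail to be Bochner integrable
  when the span is not separable.

  Second, both push-forwards must have an integrable \<open>sqrt (\<kappa>(x,x)) = \<parallel>k\<^sub>x\<parallel>\<close>, while this is assumed
  for one of them. The reverse triangle inequality passes it to the other one when the right-hand side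
  is finite (\<open>kernel_probs_distr_transfer\<close>), and an infinite right-hand side leaves nothing to prove.
\<close>

section \<open>The Hoelder inequality for extended exponents\<close>

text \<open>
  The core case: both exponents are finite and both integrals are finite and nonzero, so that \<open>u\<close> and
  \<open>v\<close> can be normalised before Young's inequality is applied pointwise.
\<close>

lemma nn_integral_Holder_powr:
  fixes u v :: "'a \<Rightarrow> real" and p q :: real
  assumes [measurable]: "u \<in> borel_measurable M" "v \<in> borel_measurable M"
    and "\<And>x. u x \<ge> 0" "\<And>x. v x \<ge> 0"
    and "p > 1" "q > 1" "1 / p + 1 / q = 1"
    and I: "(\<integral>\<^sup>+x. ennreal (u x powr p) \<partial>M) = ennreal I" "I > 0"
    and J: "(\<integral>\<^sup>+x. ennreal (v x powr q) \<partial>M) = ennreal J" "J > 0"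
  shows "(\<integral>\<^sup>+x. ennreal (u x * v x) \<partial>M) \<le> ennreal (I powr (1 / p) * J powr (1 / q))"
proof -
  define \<alpha> where "\<alpha> = I powr (1 / p)"
  define \<beta> where "\<beta> = J powr (1 / q)"
  have pos: "\<alpha> > 0" "\<beta> > 0"
    using I J by (simp_all add: \<alpha>_def \<beta>_def)
  have pow: "\<alpha> powr p = I" "\<beta> powr q = J"
    using assms(5,6) I J by (simp_all add: \<alpha>_def \<beta>_def powr_powr)
  have "u x * v x \<le> \<alpha> * \<beta> * (1 / (p * I) * u x powr p + 1 / (q * J) * v x powr q)" for x
  proof -
    have "u x / \<alpha> * (v x / \<beta>) \<le> (u x / \<alpha>) powr p / p + (v x / \<beta>) powr q / q"
      using assms pos by (intro Youngs_inequality) auto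
    also have "\<dots> = 1 / (p * I) * u x powr p + 1 / (q * J) * v x powr q"
      using assms pos pow by (simp add: powr_divide field_simps)
    finally show ?thesis
      using pos by (simp add: field_simps)
  qed
  then have "(\<integral>\<^sup>+x. ennreal (u x * v x) \<partial>M)
      \<le> (\<integral>\<^sup>+x. ennreal (\<alpha> * \<beta> * (1 / (p * I) * u x powr p + 1 / (q * J) * v x powr q)) \<partial>M)"
    by (intro nn_integral_mono ennreal_leI)
  also have "\<dots> = (\<integral>\<^sup>+x. ennreal (\<alpha> * \<beta>) * (ennreal (1 / (p * I)) * ennreal (u x powr p)
      + ennreal (1 / (q * J)) * ennreal (v x powr q)) \<partial>M)"
    using pos assms(5,6) I(2) J(2)
    by (intro nn_integral_cong) (simp flip: ennreal_mult ennreal_plus)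
  also have "\<dots> = ennreal (\<alpha> * \<beta>) * (ennreal (1 / (p * I)) * ennreal I + ennreal (1 / (q * J)) * ennreal J)"
    by (simp add: nn_integral_cmult nn_integral_add I(1) J(1))
  also have "\<dots> = ennreal (\<alpha> * \<beta> * (1 / p + 1 / q))"
    using pos assms(5,6) I(2) J(2) by (simp flip: ennreal_mult ennreal_plus)
  finally show ?thesis
    using assms(7) by (simp add: \<alpha>_def \<beta>_def)
qed

lemma AE_eq_0_of_Lp_norm_eq_0:
  assumes [measurable]: "f \<in> borel_measurable M"
    and "r > 0" "Lp_norm (ennreal r) M f = 0"
  shows "AE x in M. f x = 0"
proof -
  let ?I = "\<integral>\<^sup>+x. ennreal (norm (f x) powr r) \<partial>M"
  have "?I = 0"
    using assms(2,3) by (auto simp: Lp_norm_def Let_def enn2real_eq_0_iff split: if_splits)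
  then have "AE x in M. ennreal (norm (f x) powr r) = 0"
    by (subst (asm) nn_integral_0_iff_AE) auto
  then show ?thesis by eventually_elim simp
qed

lemma Lp_norm_infinity_Holder:
  assumes [measurable]: "f \<in> borel_measurable M" "g \<in> borel_measurable M"
  shows "(\<integral>\<^sup>+x. ennreal (norm (f x) * norm (g x)) \<partial>M) \<le> Lp_norm \<infinity> M f * Lp_norm 1 M g"
proof -
  have "AE x in M. ennreal (norm (f x)) \<le> Lp_norm \<infinity> M f"
    unfolding Lp_norm_def using esssup_AE[of "\<lambda>x. ennreal (norm (f x))" M] by simp
  then have "AE x in M. ennreal (norm (f x) * norm (g x)) \<le> Lp_norm \<infinity> M f * ennreal (norm (g x))"
    by eventually_elim (simp add: ennreal_mult mult_right_mono)
  then have "(\<integral>\<^sup>+x. ennreal (norm (f x) * norm (g x)) \<partial>M)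
      \<le> (\<integral>\<^sup>+x. Lp_norm \<infinity> M f * ennreal (norm (g x)) \<partial>M)"
    by (rule nn_integral_mono_AE)
  also have "\<dots> = Lp_norm \<infinity> M f * (\<integral>\<^sup>+x. ennreal (norm (g x)) \<partial>M)"
    by (simp add: nn_integral_cmult)
  also have "(\<integral>\<^sup>+x. ennreal (norm (g x)) \<partial>M) = Lp_norm 1 M g"
    by (simp add: Lp_norm_def Let_def less_top)
  finally show ?thesis .
qed

text \<open>
  Since \<open>0 * \<infinity> = 0\<close> in the extended reals, a vanishing norm has to be treated before an infinite one:
  it makes one of the functions zero almost everywhere.
\<close>

lemma Lp_norm_Holder:
  assumes [measurable]: "f \<in> borel_measurable M" "g \<in> borel_measurable M"
    and "p \<ge> 1" "q \<ge> 1" "1 / p + 1 / q = 1"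
  shows "(\<integral>\<^sup>+x. ennreal (norm (f x) * norm (g x)) \<partial>M) \<le> Lp_norm p M f * Lp_norm q M g"
proof -
  \<comment> \<open>With \<open>1 / \<infinity> = 0\<close>, an infinite exponent forces the other one to be \<open>1\<close>.\<close>
  have dual: "s = 1" if "1 / \<infinity> + 1 / s = 1" "s \<ge> 1" for s :: ennreal
    using that by (cases s) (auto simp: divide_ennreal simp flip: ennreal_1)
  consider "p = \<infinity>" | "q = \<infinity>" | "p < \<infinity>" "q < \<infinity>" by (metis infinity_ennreal_def less_top)
  then show ?thesis
  proof cases
    case 1
    then show ?thesis using dual[of q] assms(4,5) Lp_norm_infinity_Holder[OF assms(1,2)] by simp
  next
    case 2
    then show ?thesis
      using dual[of p] assms(3,5) Lp_norm_infinity_Holder[OF assms(2,1)]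
      by (simp add: mult.commute add.commute)
  next
    case 3
    obtain r s where rs: "p = ennreal r" "q = ennreal s" "r \<ge> 1" "s \<ge> 1"
      using 3 assms(3,4) by (cases p; cases q) (auto simp flip: ennreal_1)
    have eq: "1 / r + 1 / s = 1"
      using assms(5) rs by (simp add: divide_ennreal flip: ennreal_1 ennreal_plus)
    have gt: "r > 1" "s > 1"
      using eq rs(3,4) by (auto simp: less_le)
    let ?I = "\<integral>\<^sup>+x. ennreal (norm (f x) powr r) \<partial>M" and ?J = "\<integral>\<^sup>+x. ennreal (norm (g x) powr s) \<partial>M"
    show ?thesis
    proof (cases "Lp_norm p M f = 0 \<or> Lp_norm q M g = 0")
      case True
      then have "(AE x in M. f x = 0) \<or> (AE x in M. g x = 0)"
        using AE_eq_0_of_Lp_norm_eq_0[OF assms(1), of r] AE_eq_0_of_Lp_norm_eq_0[OF assms(2), of s]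
          rs gt by auto
      then have "AE x in M. ennreal (norm (f x) * norm (g x)) = 0"
        by (auto elim: eventually_mono)
      then have "(\<integral>\<^sup>+x. ennreal (norm (f x) * norm (g x)) \<partial>M) = 0"
        by (subst nn_integral_0_iff_AE) auto
      then show ?thesis by simp
    next
      case nz: False
      show ?thesis
      proof (cases "?I = \<infinity> \<or> ?J = \<infinity>")
        case True
        then have "Lp_norm p M f = \<infinity> \<or> Lp_norm q M g = \<infinity>"
          using rs by (auto simp: Lp_norm_def)
        then show ?thesis
          using nz by (metis ennreal_mult_eq_top_iff infinity_ennreal_def top_greatest)
      next
        case False
        then obtain I J where IJ: "?I = ennreal I" "?J = ennreal J" "I \<ge> 0" "J \<ge> 0"
          by (cases ?I; cases ?J) auto
        have norms: "Lp_norm p M f = ennreal (I powr (1 / r))" "Lp_norm q M g = ennreal (J powr (1 / s))"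
          using rs IJ by (simp_all add: Lp_norm_def)
        have "I > 0" "J > 0" using nz norms IJ(3,4) by (auto simp: less_le)
        then show ?thesis
          using nn_integral_Holder_powr[of "\<lambda>x. norm (f x)" M "\<lambda>x. norm (g x)" r s I J] IJ gt eq
          by (simp add: norms ennreal_mult)
      qed
    qed
  qed
qed

section \<open>Geometry of the span of the kernel sections\<close>

definition kernel_section :: "'a set \<Rightarrow> ('a \<Rightarrow> 'a \<Rightarrow> real) \<Rightarrow> 'a \<Rightarrow> 'a \<Rightarrow> real" where
  "kernel_section X \<kappa> x = (\<lambda>z. if z \<in> X then \<kappa> z x else 0)"

lemma kernel_section_mem: "x \<in> X \<Longrightarrow> kernel_section X \<kappa> x \<in> kernel_span X \<kappa>"
  unfolding kernel_section_def by (rule kernel_section_in_span)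

lemma kernel_section_apply: "z \<in> X \<Longrightarrow> kernel_section X \<kappa> x z = \<kappa> z x"
  by (simp add: kernel_section_def)

lemma kernel_span_vanishes: "f \<in> kernel_span X \<kappa> \<Longrightarrow> z \<notin> X \<Longrightarrow> f z = 0"
  by (auto simp: kernel_span_def kernel_comb_def)

lemma zero_in_kernel_span: "(\<lambda>z. 0) \<in> kernel_span X \<kappa>"
proof -
  have "(\<lambda>z. 0) = kernel_comb X \<kappa> {} (\<lambda>_. 0)" by (simp add: kernel_comb_def fun_eq_iff)
  then show ?thesis by (auto simp: kernel_span_def)
qed

lemma span_inner_section:
  assumes "mercer_kernel X \<kappa>" "f \<in> kernel_span X \<kappa>" "x \<in> X"
  shows "span_inner X \<kappa> f (kernel_section X \<kappa> x) = f x"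
proof -
  have "kernel_section X \<kappa> x = kernel_comb X \<kappa> {x} (\<lambda>_. 1)"
    by (simp add: kernel_section_def kernel_comb_def fun_eq_iff)
  then show ?thesis
    using span_inner_comb_right[OF assms(1,2), of "{x}" "\<lambda>_. 1"] assms(3) by simp
qed

lemma span_norm_section:
  assumes "mercer_kernel X \<kappa>" "x \<in> X"
  shows "span_norm X \<kappa> (kernel_section X \<kappa> x) = sqrt (\<kappa> x x)"
  using span_inner_section[OF assms(1) kernel_section_mem[OF assms(2)] assms(2)]
  by (simp add: span_norm_def kernel_section_apply assms(2))

lemma span_inner_section_diff:
  assumes "mercer_kernel X \<kappa>" "f \<in> kernel_span X \<kappa>" "x \<in> X" "y \<in> X"
  shows "span_inner X \<kappa> f (\<lambda>z. kernel_section X \<kappa> x z - kernel_section X \<kappa> y z) = f x - f y"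
  using span_inner_diff_right[OF assms(1) kernel_section_mem[OF assms(3)]
      kernel_section_mem[OF assms(4)] assms(2)] span_inner_section[OF assms(1,2)] assms(3,4)
  by simp

lemma span_eval_le:
  assumes "mercer_kernel X \<kappa>" "f \<in> kernel_span X \<kappa>" "x \<in> X"
  shows "\<bar>f x\<bar> \<le> span_norm X \<kappa> f * sqrt (\<kappa> x x)"
  using span_inner_Cauchy_Schwarz[OF assms(1,2) kernel_section_mem[OF assms(3)]]
  by (simp add: span_inner_section assms span_norm_section)

lemma span_eval_diff_le:
  assumes "mercer_kernel X \<kappa>" "f \<in> kernel_span X \<kappa>" "x \<in> X" "y \<in> X"
  shows "\<bar>f x - f y\<bar>
    \<le> span_norm X \<kappa> f * span_norm X \<kappa> (\<lambda>z. kernel_section X \<kappa> x z - kernel_section X \<kappa> y z)"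
  using span_inner_Cauchy_Schwarz[OF assms(1,2) kernel_span_diff[OF
      kernel_section_mem[OF assms(3)] kernel_section_mem[OF assms(4)]]]
    span_inner_section_diff[OF assms] by simp

lemma span_inner_diff_diff:
  assumes "mercer_kernel X \<kappa>" "f \<in> kernel_span X \<kappa>" "g \<in> kernel_span X \<kappa>"
  shows "span_inner X \<kappa> (\<lambda>z. f z - g z) (\<lambda>z. f z - g z)
    = span_inner X \<kappa> f f - 2 * span_inner X \<kappa> f g + span_inner X \<kappa> g g"
  using span_inner_diff_left[OF assms kernel_span_diff[OF assms(2,3)]]
    span_inner_diff_right[OF assms assms(2)] span_inner_diff_right[OF assms assms(3)]
    span_inner_sym[OF assms]
  by simp

lemma span_norm_triangle_diff:
  assumes "mercer_kernel X \<kappa>" "f \<in> kernel_span X \<kappa>" "g \<in> kernel_span X \<kappa>"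
  shows "span_norm X \<kappa> (\<lambda>z. f z - g z) \<le> span_norm X \<kappa> f + span_norm X \<kappa> g"
    and "\<bar>span_norm X \<kappa> f - span_norm X \<kappa> g\<bar> \<le> span_norm X \<kappa> (\<lambda>z. f z - g z)"
proof -
  let ?N = "span_norm X \<kappa>" and ?d = "\<lambda>z. f z - g z"
  have d: "?d \<in> kernel_span X \<kappa>" by (rule kernel_span_diff[OF assms(2,3)])
  have nn: "?N f \<ge> 0" "?N g \<ge> 0" "?N ?d \<ge> 0"
    using assms d by (auto intro: span_norm_nonneg)
  have sq: "(?N ?d)\<^sup>2 = (?N f)\<^sup>2 - 2 * span_inner X \<kappa> f g + (?N g)\<^sup>2"
    using span_inner_diff_diff[OF assms] by (simp add: span_norm_power2 assms d)
  have cs: "\<bar>span_inner X \<kappa> f g\<bar> \<le> ?N f * ?N g"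
    by (rule span_inner_Cauchy_Schwarz[OF assms])
  have "(?N ?d)\<^sup>2 \<le> (?N f + ?N g)\<^sup>2"
    using sq cs power2_sum[of "?N f" "?N g"] by linarith
  then show "?N ?d \<le> ?N f + ?N g"
    by (rule power2_le_imp_le) (intro add_nonneg_nonneg nn)
  have "\<bar>?N f - ?N g\<bar>\<^sup>2 \<le> (?N ?d)\<^sup>2"
    using sq cs power2_diff[of "?N f" "?N g"] unfolding power2_abs by linarith
  then show "\<bar>?N f - ?N g\<bar> \<le> ?N ?d"
    by (rule power2_le_imp_le) (rule nn)
qed

lemma diagonal_le_section_dist:
  assumes "mercer_kernel X \<kappa>" "x \<in> X" "y \<in> X"
  shows "\<bar>sqrt (\<kappa> x x) - sqrt (\<kappa> y y)\<bar>
    \<le> span_norm X \<kappa> (\<lambda>z. kernel_section X \<kappa> x z - kernel_section X \<kappa> y z)"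
  using span_norm_triangle_diff(2)[OF assms(1) kernel_section_mem[OF assms(2)]
      kernel_section_mem[OF assms(3)]]
  by (simp add: span_norm_section assms)

lemma represents_diff:
  assumes "mercer_kernel X \<kappa>" "represents X \<kappa> F f" "represents X \<kappa> G g"
  shows "represents X \<kappa> (\<lambda>n z. F n z - G n z) (\<lambda>z. f z - g z)"
  unfolding represents_def
proof (intro conjI allI impI)
  have F: "F n \<in> kernel_span X \<kappa>" and G: "G n \<in> kernel_span X \<kappa>" for n
    using assms by (simp_all add: represents_def)
  show "(\<lambda>z. F n z - G n z) \<in> kernel_span X \<kappa>" for n by (rule kernel_span_diff[OF F G])
  show "(\<lambda>n. F n z - G n z) \<longlonglongrightarrow> f z - g z" for z
    using assms by (intro tendsto_diff) (auto simp: represents_def)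
  fix e :: real assume "e > 0"
  then have e2: "e / 2 > 0" by simp
  obtain M where M: "\<And>m n. m \<ge> M \<Longrightarrow> n \<ge> M \<Longrightarrow> span_norm X \<kappa> (\<lambda>z. F m z - F n z) < e / 2"
    using assms(2) e2 unfolding represents_def by meson
  obtain N where N: "\<And>m n. m \<ge> N \<Longrightarrow> n \<ge> N \<Longrightarrow> span_norm X \<kappa> (\<lambda>z. G m z - G n z) < e / 2"
    using assms(3) e2 unfolding represents_def by meson
  have "span_norm X \<kappa> (\<lambda>z. F m z - G m z - (F n z - G n z)) < e"
    if "m \<ge> max M N" "n \<ge> max M N" for m n
  proof -
    have "(\<lambda>z. F m z - G m z - (F n z - G n z)) = (\<lambda>z. (F m z - F n z) - (G m z - G n z))"
      by (simp add: fun_eq_iff)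
    then show ?thesis
      using span_norm_triangle_diff(1)[OF assms(1) kernel_span_diff[OF F F] kernel_span_diff[OF G G],
          of m n m n] M[of m n] N[of m n] that
      by simp
  qed
  then show "\<exists>K. \<forall>m\<ge>K. \<forall>n\<ge>K. span_norm X \<kappa> (\<lambda>z. F m z - G m z - (F n z - G n z)) < e"
    by blast
qed

lemma rkhs_inner_diff_diff:
  assumes "mercer_kernel X \<kappa>" "f \<in> rkhs X \<kappa>" "g \<in> rkhs X \<kappa>"
  shows "rkhs_inner X \<kappa> (\<lambda>z. f z - g z) (\<lambda>z. f z - g z)
    = rkhs_inner X \<kappa> f f - 2 * rkhs_inner X \<kappa> f g + rkhs_inner X \<kappa> g g"
proof -
  obtain F G where FG: "represents X \<kappa> F f" "represents X \<kappa> G g"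
    using assms by (auto simp: rkhs_def)
  have span: "F n \<in> kernel_span X \<kappa>" "G n \<in> kernel_span X \<kappa>" for n
    using FG by (simp_all add: represents_def)
  have "(\<lambda>n. span_inner X \<kappa> (F n) (F n) - 2 * span_inner X \<kappa> (F n) (G n) + span_inner X \<kappa> (G n) (G n))
      \<longlonglongrightarrow> rkhs_inner X \<kappa> f f - 2 * rkhs_inner X \<kappa> f g + rkhs_inner X \<kappa> g g"
    using FG assms(1) by (intro tendsto_intros rkhs_inner_eq)
  moreover have "(\<lambda>n. span_inner X \<kappa> (F n) (F n) - 2 * span_inner X \<kappa> (F n) (G n)
      + span_inner X \<kappa> (G n) (G n)) \<longlonglongrightarrow> rkhs_inner X \<kappa> (\<lambda>z. f z - g z) (\<lambda>z. f z - g z)"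
    using rkhs_inner_eq[OF assms(1) represents_diff[OF assms(1) FG] represents_diff[OF assms(1) FG]]
    by (simp add: span_inner_diff_diff[OF assms(1) span])
  ultimately show ?thesis by (rule LIMSEQ_unique[symmetric])
qed

text \<open>
  Distances in a Hilbert space depend only on inner products, and every feature map has the inner
  products \<open>\<kappa>(x,y)\<close>. Thus a Lipschitz bound for \<open>\<psi>\<close> is one for the canonical map \<open>x \<mapsto> \<kappa>(\<cdot>,x)\<close>.
\<close>

lemma feature_map_dist:
  assumes "mercer_kernel X \<kappa>" "feature_map X \<kappa> \<psi>" "x \<in> X" "y \<in> X"
  shows "span_norm X \<kappa> (\<lambda>z. kernel_section X \<kappa> x z - kernel_section X \<kappa> y z)
    = rkhs_norm X \<kappa> (\<lambda>z. \<psi> x z - \<psi> y z)"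
proof -
  have "\<psi> x \<in> rkhs X \<kappa>" "\<psi> y \<in> rkhs X \<kappa>"
    using assms by (simp_all add: feature_map_def)
  then have "rkhs_inner X \<kappa> (\<lambda>z. \<psi> x z - \<psi> y z) (\<lambda>z. \<psi> x z - \<psi> y z) = \<kappa> x x - 2 * \<kappa> x y + \<kappa> y y"
    using assms by (simp add: rkhs_inner_diff_diff feature_map_def)
  moreover have "span_inner X \<kappa> (\<lambda>z. kernel_section X \<kappa> x z - kernel_section X \<kappa> y z)
      (\<lambda>z. kernel_section X \<kappa> x z - kernel_section X \<kappa> y z) = \<kappa> x x - 2 * \<kappa> x y + \<kappa> y y"
    using assms(3,4)
    by (simp add: span_inner_diff_diff[OF assms(1)] span_inner_section[OF assms(1)]
        kernel_section_mem kernel_section_apply mercer_kernel_sym[OF assms(1), of y x])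
  ultimately show ?thesis by (simp add: span_norm_def rkhs_norm_def)
qed

section \<open>Riesz representation inside the function space\<close>

text \<open>
  If \<open>f\<close> minimises \<open>J f = \<parallel>f\<parallel>\<^sup>2 / 2 - T f\<close> up to \<open>e\<^sup>2 / 2\<close>, then moving from \<open>f\<close> in any direction \<open>g\<close>
  lowers \<open>J\<close> by less than \<open>e\<^sup>2 / 2\<close>, and optimising the step length turns this into the bound. The
  span need not be complete, hence only approximate representers can be expected in it.
\<close>

lemma almost_representer_exists:
  assumes "mercer_kernel X \<kappa>"
    and lin: "\<And>f g s t. f \<in> kernel_span X \<kappa> \<Longrightarrow> g \<in> kernel_span X \<kappa> \<Longrightarrow>
      T (\<lambda>z. s * f z + t * g z) = s * T f + t * T g"
    and bnd: "\<And>f. f \<in> kernel_span X \<kappa> \<Longrightarrow> T f \<le> C * span_norm X \<kappa> f"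
    and "e > 0"
  shows "\<exists>f\<in>kernel_span X \<kappa>. \<forall>g\<in>kernel_span X \<kappa>. \<bar>span_inner X \<kappa> f g - T g\<bar> \<le> e * span_norm X \<kappa> g"
proof -
  define J where "J f = span_inner X \<kappa> f f / 2 - T f" for f
  \<comment> \<open>Boundedness of \<open>T\<close> makes \<open>J\<close> bounded below.\<close>
  have "J f \<ge> - C\<^sup>2 / 2" if "f \<in> kernel_span X \<kappa>" for f
  proof -
    have "(span_norm X \<kappa> f - C)\<^sup>2 \<ge> 0" by simp
    then show ?thesis
      using bnd[OF that] span_norm_power2[OF assms(1) that] by (simp add: J_def power2_diff algebra_simps)
  qed
  then have bdd: "bdd_below (J ` kernel_span X \<kappa>)"
    by (intro bdd_belowI2)
  have ne: "J ` kernel_span X \<kappa> \<noteq> {}" using zero_in_kernel_span by blast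
  obtain f where f: "f \<in> kernel_span X \<kappa>" "J f < Inf (J ` kernel_span X \<kappa>) + e\<^sup>2 / 2"
    using cInf_lessD[OF ne, of "Inf (J ` kernel_span X \<kappa>) + e\<^sup>2 / 2"] assms(4) by auto
  have "\<bar>span_inner X \<kappa> f g - T g\<bar> \<le> e * span_norm X \<kappa> g" if g: "g \<in> kernel_span X \<kappa>" for g
  proof -
    define a where "a = span_inner X \<kappa> f g - T g"
    define n where "n = span_inner X \<kappa> g g"
    have pos: "t * a + t\<^sup>2 * n / 2 + e\<^sup>2 / 2 > 0" for t
    proof -
      let ?h = "\<lambda>z. 1 * f z + t * g z"
      have h: "?h \<in> kernel_span X \<kappa>" by (rule kernel_span_lincomb[OF f(1) g])
      have "span_inner X \<kappa> ?h ?h = span_inner X \<kappa> f ?h + t * span_inner X \<kappa> g ?h"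
        using span_inner_lincomb_left[OF assms(1) f(1) g h, of 1 t] by simp
      also have "span_inner X \<kappa> f ?h = span_inner X \<kappa> f f + t * span_inner X \<kappa> f g"
        using span_inner_lincomb_left[OF assms(1) f(1) g f(1), of 1 t]
          span_inner_sym[OF assms(1) f(1) h] span_inner_sym[OF assms(1) f(1) g] by simp
      also have "span_inner X \<kappa> g ?h = span_inner X \<kappa> f g + t * n"
        using span_inner_lincomb_left[OF assms(1) f(1) g g, of 1 t]
          span_inner_sym[OF assms(1) g h] by (simp add: n_def)
      finally have "J ?h = J f + (t * a + t\<^sup>2 * n / 2)"
        using lin[OF f(1) g, of 1 t] by (simp add: J_def a_def power2_eq_square algebra_simps)
      moreover have "Inf (J ` kernel_span X \<kappa>) \<le> J ?h"
        using bdd h by (intro cInf_lower) auto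
      ultimately show ?thesis using f(2) by linarith
    qed
    have n: "n \<ge> 0" "n = (span_norm X \<kappa> g)\<^sup>2"
      using assms(1) g by (simp_all add: n_def span_inner_nonneg span_norm_power2)
    \<comment> \<open>The quadratic in \<open>t\<close> is positive, so its discriminant \<open>a\<^sup>2 - e\<^sup>2 * n\<close> is not. For \<open>n \<noteq> 0\<close> the step
      \<open>t = - a / n\<close> is its minimum; for \<open>n = 0\<close> it is linear and must be constant.\<close>
    have "a\<^sup>2 \<le> e\<^sup>2 * n"
    proof (cases "n = 0")
      case True
      have "a = 0"
      proof (rule ccontr)
        assume "a \<noteq> 0"
        then show False using pos[of "- e\<^sup>2 / a"] True assms(4) by simp
      qed
      then show ?thesis using n by simp
    next
      case False
      then have "n > 0" using n by simp
      then show ?thesis using pos[of "- a / n"] by (simp add: power2_eq_square field_simps)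
    qed
    then have "\<bar>a\<bar>\<^sup>2 \<le> (e * span_norm X \<kappa> g)\<^sup>2"
      by (simp add: n power_mult_distrib)
    then show ?thesis
      unfolding a_def[symmetric]
      by (rule power2_le_imp_le) (use assms(4) span_norm_nonneg[OF assms(1) g] in auto)
  qed
  then show ?thesis using f(1) by blast
qed

text \<open>
  Approximate representers with error \<open>\<epsilon> n \<longlonglongrightarrow> 0\<close> are Cauchy: testing two of them against their
  difference gives distance at most \<open>\<epsilon> m + \<epsilon> n\<close>. Tested against a section they converge to \<open>h\<close> at
  that point, and tested against themselves they have norm at most \<open>C + \<epsilon> n\<close>.
\<close>

lemma rkhs_norm_representer_le:
  assumes "mercer_kernel X \<kappa>" "C \<ge> 0"
    and lin: "\<And>f g s t. f \<in> kernel_span X \<kappa> \<Longrightarrow> g \<in> kernel_span X \<kappa> \<Longrightarrow>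
      T (\<lambda>z. s * f z + t * g z) = s * T f + t * T g"
    and bnd: "\<And>f. f \<in> kernel_span X \<kappa> \<Longrightarrow> T f \<le> C * span_norm X \<kappa> f"
    and h: "\<And>z. z \<in> X \<Longrightarrow> h z = T (kernel_section X \<kappa> z)" "\<And>z. z \<notin> X \<Longrightarrow> h z = 0"
  shows "rkhs_norm X \<kappa> h \<le> C"
proof -
  define \<epsilon> where "\<epsilon> n = inverse (real (Suc n))" for n
  have \<epsilon>: "\<epsilon> \<longlonglongrightarrow> 0" "\<And>n. \<epsilon> n > 0"
    unfolding \<epsilon>_def by (rule LIMSEQ_inverse_real_of_nat) simp
  have "\<exists>f\<in>kernel_span X \<kappa>. \<forall>g\<in>kernel_span X \<kappa>.
      \<bar>span_inner X \<kappa> f g - T g\<bar> \<le> \<epsilon> n * span_norm X \<kappa> g" for n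
    by (rule almost_representer_exists[OF assms(1) lin bnd \<epsilon>(2)])
  then obtain F where F: "\<And>n. F n \<in> kernel_span X \<kappa>"
    and approx: "\<And>n g. g \<in> kernel_span X \<kappa> \<Longrightarrow> \<bar>span_inner X \<kappa> (F n) g - T g\<bar> \<le> \<epsilon> n * span_norm X \<kappa> g"
    by metis
  have cancel: "x \<le> c" if "x * x \<le> c * x" "x \<ge> 0" "c \<ge> 0" for x c :: real
    using that by (cases "x = 0") (auto simp: mult_le_cancel_right)
  have bound: "span_norm X \<kappa> (F n) \<le> C + \<epsilon> n" for n
  proof -
    have "span_norm X \<kappa> (F n) * span_norm X \<kappa> (F n) \<le> (C + \<epsilon> n) * span_norm X \<kappa> (F n)"
      using approx[OF F, of n n] bnd[OF F[of n]] span_norm_power2[OF assms(1) F, of n]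
      unfolding power2_eq_square distrib_right by linarith
    then show ?thesis
      by (rule cancel) (use span_norm_nonneg[OF assms(1) F] assms(2) \<epsilon>(2)[of n] in auto)
  qed
  have rep: "represents X \<kappa> F h"
    unfolding represents_def
  proof (intro conjI allI impI)
    fix e :: real assume "e > 0"
    obtain N where N: "\<And>n. n \<ge> N \<Longrightarrow> \<epsilon> n < e / 2"
      using order_tendstoD(2)[OF \<epsilon>(1), of "e / 2"] \<open>e > 0\<close> by (auto simp: eventually_sequentially)
    have "span_norm X \<kappa> (\<lambda>z. F m z - F n z) < e" if "m \<ge> N" "n \<ge> N" for m n
    proof -
      let ?d = "\<lambda>z. F m z - F n z"
      have d: "?d \<in> kernel_span X \<kappa>" by (rule kernel_span_diff[OF F F])
      have "span_norm X \<kappa> ?d * span_norm X \<kappa> ?d = span_inner X \<kappa> (F m) ?d - span_inner X \<kappa> (F n) ?d"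
        using span_norm_power2[OF assms(1) d] span_inner_diff_left[OF assms(1) F F d]
        by (simp add: power2_eq_square)
      also have "\<dots> \<le> (\<epsilon> m + \<epsilon> n) * span_norm X \<kappa> ?d"
        using approx[OF d, of m] approx[OF d, of n] unfolding distrib_right by linarith
      finally have "span_norm X \<kappa> ?d \<le> \<epsilon> m + \<epsilon> n"
        by (rule cancel) (use span_norm_nonneg[OF assms(1) d] \<epsilon>(2)[of m] \<epsilon>(2)[of n] in auto)
      then show ?thesis using N[OF that(1)] N[OF that(2)] by linarith
    qed
    then show "\<exists>N. \<forall>m\<ge>N. \<forall>n\<ge>N. span_norm X \<kappa> (\<lambda>z. F m z - F n z) < e" by blast
  next
    fix z
    show "(\<lambda>n. F n z) \<longlonglongrightarrow> h z"
    proof (cases "z \<in> X")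
      case True
      have "\<bar>F n z - h z\<bar> \<le> \<epsilon> n * sqrt (\<kappa> z z)" for n
        using approx[OF kernel_section_mem[OF True], of n]
        by (simp add: span_inner_section[OF assms(1) F True] span_norm_section[OF assms(1) True]
            h(1)[OF True])
      moreover have "(\<lambda>n. \<epsilon> n * sqrt (\<kappa> z z)) \<longlonglongrightarrow> 0"
        using tendsto_mult_left_zero[OF \<epsilon>(1)] by blast
      ultimately have "(\<lambda>n. F n z - h z) \<longlonglongrightarrow> 0"
        by (intro Lim_null_comparison[of "\<lambda>n. F n z - h z"] always_eventually) auto
      then show ?thesis by (simp add: LIM_zero_iff)
    next
      case False
      then show ?thesis using kernel_span_vanishes[OF F] by (simp add: h)
    qed
  qed (rule F)
  have "(\<lambda>n. span_norm X \<kappa> (F n)) \<longlonglongrightarrow> rkhs_norm X \<kappa> h"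
    unfolding rkhs_norm_def span_norm_def
    by (intro tendsto_real_sqrt rkhs_inner_eq[OF assms(1) rep rep])
  moreover have "(\<lambda>n. C + \<epsilon> n) \<longlonglongrightarrow> C + 0" by (intro tendsto_intros \<epsilon>(1))
  ultimately have "rkhs_norm X \<kappa> h \<le> C + 0"
    by (rule LIMSEQ_le) (use bound in auto)
  then show ?thesis by simp
qed

section \<open>Mean embeddings and the coupling bound\<close>

lemma kernel_span_measurable:
  assumes meas: "\<And>y. y \<in> X \<Longrightarrow> (\<lambda>x. \<kappa> x y) \<in> borel_measurable (restrict_space borel X)"
    and "f \<in> kernel_span X \<kappa>"
  shows "f \<in> borel_measurable (restrict_space borel X)"
proof -
  obtain A c where A: "A \<subseteq> X" "f = kernel_comb X \<kappa> A c"
    using assms(2) by (auto simp: kernel_span_def)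
  have "(\<lambda>z. \<Sum>x\<in>A. c x * \<kappa> z x) \<in> borel_measurable (restrict_space borel X)"
    using A(1) meas by (intro borel_measurable_sum borel_measurable_times) auto
  moreover have "f z = (\<Sum>x\<in>A. c x * \<kappa> z x)" if "z \<in> space (restrict_space borel X)" for z
    using that by (simp add: A kernel_comb_def space_restrict_space)
  ultimately show ?thesis by (subst measurable_cong)
qed

text \<open>
  The reproducing property bounds \<open>f\<close> pointwise by a multiple of \<open>sqrt (\<kappa>(x,x))\<close>, which is integrable
  for measures in \<open>kernel_probs\<close>.
\<close>

lemma kernel_span_integrable:
  assumes "mercer_kernel X \<kappa>"
    and meas: "\<And>y. y \<in> X \<Longrightarrow> (\<lambda>x. \<kappa> x y) \<in> borel_measurable (restrict_space borel X)"
    and \<rho>: "\<rho> \<in> kernel_probs X \<kappa>" and f: "f \<in> kernel_span X \<kappa>"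
  shows "integrable \<rho> f"
proof (rule Bochner_Integration.integrable_bound)
  have sets: "sets \<rho> = sets (restrict_space borel X)"
    using \<rho> by (simp add: kernel_probs_def borel_probs_def)
  have space: "space \<rho> = X"
    using sets_eq_imp_space_eq[OF sets] by (simp add: space_restrict_space)
  show "integrable \<rho> (\<lambda>x. span_norm X \<kappa> f * sqrt (\<kappa> x x))"
    using \<rho> by (auto simp: kernel_probs_def)
  show "f \<in> borel_measurable \<rho>"
    using kernel_span_measurable[OF meas f] measurable_cong_sets[OF sets refl] by blast
  show "AE x in \<rho>. norm (f x) \<le> norm (span_norm X \<kappa> f * sqrt (\<kappa> x x))"
    using span_eval_le[OF assms(1) f] by (intro AE_I2) (force simp: space)
qed

text \<open>
  The duality between MMD and integration: the difference of the mean embeddings represents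
  \<open>f \<mapsto> \<integral> f d\<rho> - \<integral> f d\<rho>'\<close>, and testing this functional on the span suffices to bound its norm.
\<close>

lemma mean_embedding_diff_norm_le:
  assumes "mercer_kernel X \<kappa>"
    and meas: "\<And>y. y \<in> X \<Longrightarrow> (\<lambda>x. \<kappa> x y) \<in> borel_measurable (restrict_space borel X)"
    and \<rho>: "\<rho> \<in> kernel_probs X \<kappa>" "\<rho>' \<in> kernel_probs X \<kappa>" and "C \<ge> 0"
    and bnd: "\<And>f. f \<in> kernel_span X \<kappa> \<Longrightarrow> (LINT x|\<rho>. f x) - (LINT x|\<rho>'. f x) \<le> C * span_norm X \<kappa> f"
  shows "rkhs_norm X \<kappa> (\<lambda>z. mean_embedding X \<kappa> \<rho> z - mean_embedding X \<kappa> \<rho>' z) \<le> C"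
proof (rule rkhs_norm_representer_le[OF assms(1) \<open>C \<ge> 0\<close> _ bnd])
  fix f g s t assume "f \<in> kernel_span X \<kappa>" "g \<in> kernel_span X \<kappa>"
  then have "integrable \<rho> f" "integrable \<rho> g" "integrable \<rho>' f" "integrable \<rho>' g"
    using kernel_span_integrable[OF assms(1) meas] \<rho> by auto
  then show "(LINT z|\<rho>. s * f z + t * g z) - (LINT z|\<rho>'. s * f z + t * g z)
      = s * ((LINT z|\<rho>. f z) - (LINT z|\<rho>'. f z)) + t * ((LINT z|\<rho>. g z) - (LINT z|\<rho>'. g z))"
    by (simp add: algebra_simps)
next
  fix z assume z: "z \<in> X"
  have "(LINT x|\<sigma>. kernel_section X \<kappa> z x) = (LINT x|\<sigma>. \<kappa> x z)" if "\<sigma> \<in> kernel_probs X \<kappa>" for \<sigma>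
  proof (rule Bochner_Integration.integral_cong[OF refl])
    have "space \<sigma> = X"
      using that sets_eq_imp_space_eq[of \<sigma> "restrict_space borel X"]
      by (simp add: kernel_probs_def borel_probs_def space_restrict_space)
    then show "x \<in> space \<sigma> \<Longrightarrow> kernel_section X \<kappa> z x = \<kappa> x z" for x
      by (simp add: kernel_section_apply)
  qed
  then show "mean_embedding X \<kappa> \<rho> z - mean_embedding X \<kappa> \<rho>' z
      = (LINT x|\<rho>. kernel_section X \<kappa> z x) - (LINT x|\<rho>'. kernel_section X \<kappa> z x)"
    using \<rho> z by (simp add: mean_embedding_def)
next
  fix z assume "z \<notin> X"
  then show "mean_embedding X \<kappa> \<rho> z - mean_embedding X \<kappa> \<rho>' z = 0"
    by (simp add: mean_embedding_def)
qed

text \<open>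
  The function \<open>sqrt (\<kappa>(x,x)) = \<parallel>k\<^sub>x\<parallel>\<close> changes between \<open>F \<omega>\<close> and \<open>G \<omega>\<close> by at most \<open>d \<omega>\<close>. Measurability
  of the sections of \<open>\<kappa>\<close> does not make its diagonal measurable; that comes from integrability against
  the first push-forward, which has the same measurable sets as the second.
\<close>

lemma kernel_probs_distr_transfer:
  assumes "mercer_kernel X \<kappa>" "prob_space M"
    and F: "F \<in> measurable M (restrict_space borel X)" and G: "G \<in> measurable M (restrict_space borel X)"
    and d: "integrable M d"
    and le: "\<And>\<omega>. \<omega> \<in> space M \<Longrightarrow> span_norm X \<kappa>
      (\<lambda>z. kernel_section X \<kappa> (F \<omega>) z - kernel_section X \<kappa> (G \<omega>) z) \<le> d \<omega>"
    and "distr M (restrict_space borel X) F \<in> kernel_probs X \<kappa>"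
  shows "distr M (restrict_space borel X) G \<in> kernel_probs X \<kappa>"
proof -
  let ?k = "\<lambda>x. sqrt (\<kappa> x x)"
  have int: "integrable (distr M (restrict_space borel X) F) ?k"
    using assms(7) by (simp add: kernel_probs_def)
  then have k: "?k \<in> borel_measurable (restrict_space borel X)"
    using borel_measurable_integrable by fastforce
  have FX: "F \<omega> \<in> X" and GX: "G \<omega> \<in> X" if "\<omega> \<in> space M" for \<omega>
    using measurable_space[OF F that] measurable_space[OF G that] by (auto simp: space_restrict_space)
  have "integrable M (\<lambda>\<omega>. ?k (F \<omega>) + d \<omega>)"
    using int d by (simp add: integrable_distr_eq[OF F k])
  then have "integrable M (\<lambda>\<omega>. ?k (G \<omega>))"
  proof (rule Bochner_Integration.integrable_bound)
    show "(\<lambda>\<omega>. ?k (G \<omega>)) \<in> borel_measurable M"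
      using measurable_compose[OF G k] .
    have "\<bar>?k (G \<omega>)\<bar> \<le> \<bar>?k (F \<omega>) + d \<omega>\<bar>" if "\<omega> \<in> space M" for \<omega>
    proof -
      have "?k (G \<omega>) \<ge> 0"
        using span_norm_nonneg[OF assms(1) kernel_section_mem[OF GX[OF that]]]
        by (simp add: span_norm_section[OF assms(1) GX[OF that]])
      then show ?thesis
        using diagonal_le_section_dist[OF assms(1) FX GX, OF that that] le[OF that] by linarith
    qed
    then show "AE \<omega> in M. norm (?k (G \<omega>)) \<le> norm (?k (F \<omega>) + d \<omega>)"
      by (intro AE_I2) simp
  qed
  then show ?thesis
    using prob_space.prob_space_distr[OF assms(2) G]
    by (simp add: kernel_probs_def borel_probs_def integrable_distr_eq[OF G k])
qed

text \<open>
  A coupling bound: MMD is at most the mean distance of the sections at the coupled points. The distance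
  \<open>\<omega> \<mapsto> \<parallel>k\<^bsub>F \<omega>\<^esub> - k\<^bsub>G \<omega>\<^esub>\<parallel>\<close> itself may fail to be measurable when \<open>\<kappa>\<close> is measurable in each argument
  only, so it is replaced by a measurable majorant \<open>d\<close>.
\<close>

lemma MMD_distr_le:
  assumes "mercer_kernel X \<kappa>"
    and meas: "\<And>y. y \<in> X \<Longrightarrow> (\<lambda>x. \<kappa> x y) \<in> borel_measurable (restrict_space borel X)"
    and "prob_space M"
    and F: "F \<in> measurable M (restrict_space borel X)" and G: "G \<in> measurable M (restrict_space borel X)"
    and d: "d \<in> borel_measurable M"
    and le: "\<And>\<omega>. \<omega> \<in> space M \<Longrightarrow> span_norm X \<kappa>
      (\<lambda>z. kernel_section X \<kappa> (F \<omega>) z - kernel_section X \<kappa> (G \<omega>) z) \<le> d \<omega>"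
    and ker: "distr M (restrict_space borel X) F \<in> kernel_probs X \<kappa> \<or>
      distr M (restrict_space borel X) G \<in> kernel_probs X \<kappa>"
  shows "MMD X \<kappa> (distr M (restrict_space borel X) F) (distr M (restrict_space borel X) G)
    \<le> (\<integral>\<^sup>+\<omega>. ennreal (d \<omega>) \<partial>M)"
proof (cases "(\<integral>\<^sup>+\<omega>. ennreal (d \<omega>) \<partial>M) = \<infinity>")
  case False
  let ?\<rho> = "distr M (restrict_space borel X) F" and ?\<rho>' = "distr M (restrict_space borel X) G"
  let ?dist = "\<lambda>x y. span_norm X \<kappa> (\<lambda>z. kernel_section X \<kappa> x z - kernel_section X \<kappa> y z)"
  have X: "F \<omega> \<in> X" "G \<omega> \<in> X" if "\<omega> \<in> space M" for \<omega>
    using measurable_space[OF F that] measurable_space[OF G that] by (auto simp: space_restrict_space)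
  have d0: "d \<omega> \<ge> 0" if "\<omega> \<in> space M" for \<omega>
    using diagonal_le_section_dist[OF assms(1) X[OF that]] le[OF that] by linarith
  have int: "integrable M d"
    using False d d0 by (intro integrableI_nonneg AE_I2) (auto simp: less_top)
  have sym: "?dist x y = ?dist y x" if "x \<in> X" "y \<in> X" for x y
    using span_inner_diff_diff[OF assms(1) kernel_section_mem kernel_section_mem, OF that]
      span_inner_diff_diff[OF assms(1) kernel_section_mem kernel_section_mem, OF that(2,1)]
      span_inner_sym[OF assms(1) kernel_section_mem kernel_section_mem, OF that]
    by (simp add: span_norm_def)
  have le': "?dist (G \<omega>) (F \<omega>) \<le> d \<omega>" if "\<omega> \<in> space M" for \<omega>
    using le[OF that] sym[OF X[OF that]] by simp
  have \<rho>: "?\<rho> \<in> kernel_probs X \<kappa>" and \<rho>': "?\<rho>' \<in> kernel_probs X \<kappa>"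
    using ker kernel_probs_distr_transfer[OF assms(1,3) F G int le]
      kernel_probs_distr_transfer[OF assms(1,3) G F int le'] by auto
  have "rkhs_norm X \<kappa> (\<lambda>z. mean_embedding X \<kappa> ?\<rho> z - mean_embedding X \<kappa> ?\<rho>' z) \<le> (LINT \<omega>|M. d \<omega>)"
  proof (rule mean_embedding_diff_norm_le[OF assms(1) meas \<rho> \<rho>'])
    show "(LINT \<omega>|M. d \<omega>) \<ge> 0" using d0 by (rule Bochner_Integration.integral_nonneg)
    fix f assume f: "f \<in> kernel_span X \<kappa>"
    have fm: "f \<in> borel_measurable (restrict_space borel X)"
      by (rule kernel_span_measurable[OF meas f])
    have intF: "integrable M (\<lambda>\<omega>. f (F \<omega>))" and intG: "integrable M (\<lambda>\<omega>. f (G \<omega>))"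
      using kernel_span_integrable[OF assms(1) meas \<rho> f] kernel_span_integrable[OF assms(1) meas \<rho>' f]
      by (simp_all add: integrable_distr_eq F G fm)
    have "(LINT x|?\<rho>. f x) - (LINT x|?\<rho>'. f x) = (LINT \<omega>|M. f (F \<omega>) - f (G \<omega>))"
      by (simp add: integral_distr F G fm intF intG)
    also have "\<dots> \<le> (LINT \<omega>|M. span_norm X \<kappa> f * d \<omega>)"
    proof (rule integral_mono)
      fix \<omega> assume \<omega>: "\<omega> \<in> space M"
      have "\<bar>f (F \<omega>) - f (G \<omega>)\<bar> \<le> span_norm X \<kappa> f * ?dist (F \<omega>) (G \<omega>)"
        by (rule span_eval_diff_le[OF assms(1) f X[OF \<omega>]])
      also have "\<dots> \<le> span_norm X \<kappa> f * d \<omega>"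
        using le[OF \<omega>] span_norm_nonneg[OF assms(1) f] by (rule mult_left_mono)
      finally show "f (F \<omega>) - f (G \<omega>) \<le> span_norm X \<kappa> f * d \<omega>" by simp
    qed (use intF intG int in auto)
    finally show "(LINT x|?\<rho>. f x) - (LINT x|?\<rho>'. f x) \<le> (LINT \<omega>|M. d \<omega>) * span_norm X \<kappa> f"
      by (simp add: mult.commute)
  qed
  then show ?thesis
    using \<rho> \<rho>' nn_integral_eq_integral[OF int AE_I2[OF d0]] by (simp add: MMD_def ennreal_leI)
qed simp

theorem theorem3p2:
  fixes \<Omega> :: "(real ^ 'd) set"
    and \<Omega>' :: "(real ^ 's) set"
    and \<mu> :: "(real ^ 'd) measure"
    and \<kappa> :: "real ^ 's \<Rightarrow> real ^ 's \<Rightarrow> real"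
    and \<psi> :: "real ^ 's \<Rightarrow> (real ^ 's \<Rightarrow> real)"
    and L :: "real ^ 's \<Rightarrow> real ^ 's \<Rightarrow> real"
    and F G :: "real ^ 'd \<Rightarrow> real ^ 's"
    and p q :: ennreal
  assumes "\<Omega> \<in> sets borel"
    and "\<Omega>' \<in> sets borel"
    and "\<mu> \<in> borel_probs \<Omega>"
    and "mercer_kernel \<Omega>' \<kappa>"
    and kernel_measurable: "\<And>y. y \<in> \<Omega>' \<Longrightarrow> (\<lambda>x. \<kappa> x y) \<in> borel_measurable (restrict_space borel \<Omega>')"
    and "feature_map \<Omega>' \<kappa> \<psi>"
    and "\<And>x y. x \<in> \<Omega>' \<Longrightarrow> y \<in> \<Omega>' \<Longrightarrow> L x y \<ge> 0"
    and "\<And>x y. x \<in> \<Omega>' \<Longrightarrow> y \<in> \<Omega>' \<Longrightarrow>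
           rkhs_norm \<Omega>' \<kappa> (\<lambda>z. \<psi> x z - \<psi> y z) \<le> L x y * norm (x - y)"
    and "p \<ge> 1" and "q \<ge> 1" and "1 / p + 1 / q = 1"
    and "F \<in> Lp_space q \<mu> \<Omega>'"
    and "G \<in> Lp_space q \<mu> \<Omega>'"
    and "(\<lambda>\<omega>. L (F \<omega>) (G \<omega>)) \<in> Lp_space p \<mu> UNIV"
    and mean_defined: "distr \<mu> (restrict_space borel \<Omega>') F \<in> kernel_probs \<Omega>' \<kappa> \<or>
           distr \<mu> (restrict_space borel \<Omega>') G \<in> kernel_probs \<Omega>' \<kappa>"
  shows "MMD \<Omega>' \<kappa> (distr \<mu> (restrict_space borel \<Omega>') F) (distr \<mu> (restrict_space borel \<Omega>') G)
         \<le> Lp_norm p \<mu> (\<lambda>\<omega>. L (F \<omega>) (G \<omega>)) * Lp_norm q \<mu> (\<lambda>\<omega>. F \<omega> - G \<omega>)"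
proof -
  have F: "F \<in> measurable \<mu> (restrict_space borel \<Omega>')" and G: "G \<in> measurable \<mu> (restrict_space borel \<Omega>')"
    and L [measurable]: "(\<lambda>\<omega>. L (F \<omega>) (G \<omega>)) \<in> borel_measurable \<mu>"
    using assms(12-14) by (simp_all add: Lp_space_def measurable_restrict_space2_iff)
  have [measurable]: "F \<in> borel_measurable \<mu>" "G \<in> borel_measurable \<mu>"
    using F G by (simp_all add: measurable_restrict_space2_iff)
  have "MMD \<Omega>' \<kappa> (distr \<mu> (restrict_space borel \<Omega>') F) (distr \<mu> (restrict_space borel \<Omega>') G)
      \<le> (\<integral>\<^sup>+\<omega>. ennreal (norm (L (F \<omega>) (G \<omega>)) * norm (F \<omega> - G \<omega>)) \<partial>\<mu>)"
  proof (rule MMD_distr_le[OF assms(4) kernel_measurable _ F G _ _ mean_defined])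
    show "prob_space \<mu>" using assms(3) by (simp add: borel_probs_def)
    fix \<omega> assume "\<omega> \<in> space \<mu>"
    then have "F \<omega> \<in> \<Omega>'" "G \<omega> \<in> \<Omega>'"
      using measurable_space[OF F] measurable_space[OF G] by (auto simp: space_restrict_space)
    then show "span_norm \<Omega>' \<kappa> (\<lambda>z. kernel_section \<Omega>' \<kappa> (F \<omega>) z - kernel_section \<Omega>' \<kappa> (G \<omega>) z)
        \<le> norm (L (F \<omega>) (G \<omega>)) * norm (F \<omega> - G \<omega>)"
      using assms(7,8) by (simp add: feature_map_dist[OF assms(4,6)])
  qed measurable
  also have "\<dots> \<le> Lp_norm p \<mu> (\<lambda>\<omega>. L (F \<omega>) (G \<omega>)) * Lp_norm q \<mu> (\<lambda>\<omega>. F \<omega> - G \<omega>)"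
    using assms(9-11) by (intro Lp_norm_Holder) auto
  finally show ?thesis .
qed

end
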